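(* Let $D$ be a finite set with $|D|=n\ge1$ and $v:2^D\to\mathbb{R}$. If $\sigma=(D)$ consists of a single group, then $\Pi_\sigma(D)=\Pi(D)$, the weights satisfy $p^\sigma_\pi=1/n!$ for every $\pi\in\Pi(D)$, and the Asymmetric Data Shapley value $\phi^\sigma$ reduces to the classical Data Shapley value: for every $z\in D$, $$\phi^\sigma(z;v,D)=\frac1{n!}\sum_{\pi\in\Pi(D)}\bigl[v(\pi^{<z}\cup\{z\})-v(\pi^{<z})\bigr]=\frac1n\sum_{S\subseteq D\setminus\{z\}}\binom{n-1}{|S|}^{-1}\bigl[v(S\cup\{z\})-v(S)\bigr].$$
   Context: $\Pi(D)$ is the set of all permutations (linear orderings) of $D$; for $\pi\in\Pi(D)$ and $z\in D$, $\pi^{<z}$ is the set of elements preceding $z$ in $\pi$. For an ordered collection $\sigma=(D_1,\ldots,D_T)$ of nonempty pairwise disjoint groups with union $D$, $\Pi_\sigma(D)\subseteq\Pi(D)$ is the set of permutations in which every element of $D_s$ comes before every element of $D_t$ whenever $s<t$. The weights are $p^\sigma_\pi=1/\prod_{t=1}^T(|D_t|!)$ if $\pi\in\Pi_\sigma(D)$ and $p^\sigma_\pi=0$ otherwise. The Asymmetric Data Shapley value is $\phi^\sigma(z;v,D)=\sum_{\pi\in\Pi(D)}p^\sigma_\pi\,[v(\pi^{<z}\cup\{z\})-v(\pi^{<z})]$. The two right-hand expressions in the claim are the permutation form and the subset form of the classical Data Shapley value. *)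

theory Defs
  imports Complex_Main "HOL-Combinatorics.Multiset_Permutations"
begin

text \<open>
  A linear ordering of a finite set \<open>D\<close> is a duplicate-free list enumerating \<open>D\<close>, i.e.
  an element of \<^const>\<open>permutations_of_set\<close>.
\<close>

definition comes_before :: "'a list \<Rightarrow> 'a \<Rightarrow> 'a \<Rightarrow> bool" where
  "comes_before \<pi> x y \<longleftrightarrow> (\<exists>i j. i < j \<and> j < length \<pi> \<and> \<pi> ! i = x \<and> \<pi> ! j = y)"

definition predecessors :: "'a list \<Rightarrow> 'a \<Rightarrow> 'a set" where
  "predecessors \<pi> z = {y. comes_before \<pi> y z}"

definition ordered_grouping :: "'a set \<Rightarrow> 'a set list \<Rightarrow> bool" where
  "ordered_grouping D \<sigma> \<longleftrightarrow>
     (\<forall>t<length \<sigma>. \<sigma> ! t \<noteq> {}) \<and>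
     (\<forall>s<length \<sigma>. \<forall>t<length \<sigma>. s \<noteq> t \<longrightarrow> \<sigma> ! s \<inter> \<sigma> ! t = {}) \<and>
     (\<Union>t<length \<sigma>. \<sigma> ! t) = D"

text \<open>
  The notions below are meant for arguments with \<^term>\<open>ordered_grouping D \<sigma>\<close>; a single
  nonempty group always satisfies this condition.
\<close>

lemma ordered_grouping_single: "D \<noteq> {} \<Longrightarrow> ordered_grouping D [D]"
  by (auto simp: ordered_grouping_def)

definition grouped_permutations :: "'a set list \<Rightarrow> 'a set \<Rightarrow> 'a list set" where
  "grouped_permutations \<sigma> D =
     {\<pi> \<in> permutations_of_set D.
        \<forall>s t. s < t \<and> t < length \<sigma> \<longrightarrow> (\<forall>x\<in>\<sigma> ! s. \<forall>y\<in>\<sigma> ! t. comes_before \<pi> x y)}"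

definition permutation_weight :: "'a set list \<Rightarrow> 'a set \<Rightarrow> 'a list \<Rightarrow> real" where
  "permutation_weight \<sigma> D \<pi> =
     (if \<pi> \<in> grouped_permutations \<sigma> D
      then 1 / (\<Prod>t<length \<sigma>. fact (card (\<sigma> ! t))) else 0)"

text \<open>
  A value function on the power set of \<open>D\<close> is a total function on sets; only its values on
  subsets of \<open>D\<close> enter.
\<close>

definition asym_data_shapley ::
  "'a set list \<Rightarrow> 'a \<Rightarrow> ('a set \<Rightarrow> real) \<Rightarrow> 'a set \<Rightarrow> real" where
  "asym_data_shapley \<sigma> z v D =
     (\<Sum>\<pi>\<in>permutations_of_set D. permutation_weight \<sigma> D \<pi> *
        (v (predecessors \<pi> z \<union> {z}) - v (predecessors \<pi> z)))"

end

theory Submission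
  imports Defs
begin

text \<open>
  The linear orderings of \<open>D\<close> in which exactly the elements of \<open>S\<close> precede \<open>z\<close> consist of an
  ordering of \<open>S\<close>, then \<open>z\<close>, then an ordering of the remaining elements. Hence there are
  \<open>|S|! (n - 1 - |S|)!\<close> of them, and grouping the sum over all orderings by the set of
  predecessors of \<open>z\<close> turns the permutation form into the subset form.
\<close>

text \<open>Distinctness forces the only position of \<open>z\<close> to be
  \<open>length xs\<close>, so the positions before it are exactly those of \<open>xs\<close>.
  Cutting a list at \<open>z\<close> thus replaces all index arguments below.\<close>

lemma predecessors_append_Cons:
  assumes "distinct (xs @ z # ys)"
  shows "predecessors (xs @ z # ys) z = set xs"
proof (intro subset_antisym subsetI)
  fix y assume "y \<in> predecessors (xs @ z # ys) z"
  then obtain i j where ij: "i < j" "j < length (xs @ z # ys)"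
      "(xs @ z # ys) ! i = y" "(xs @ z # ys) ! j = z"
    by (auto simp: predecessors_def comes_before_def)
  have "(xs @ z # ys) ! length xs = z" by simp
  with ij assms have "j = length xs"
    by (metis nth_eq_iff_index_eq length_append length_Cons less_add_Suc1 add_Suc_right)
  with ij show "y \<in> set xs" by (auto simp: nth_append)
next
  fix y assume "y \<in> set xs"
  then obtain i where "i < length xs" "xs ! i = y" by (auto simp: in_set_conv_nth)
  then have "i < length xs \<and> length xs < length (xs @ z # ys) \<and>
      (xs @ z # ys) ! i = y \<and> (xs @ z # ys) ! length xs = z"
    by (simp add: nth_append)
  then show "y \<in> predecessors (xs @ z # ys) z"
    unfolding predecessors_def comes_before_def by blast
qed

text \<open>Ensures that \<open>Pow (D - {z})\<close> indexes all fibres when the orderings are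
  grouped by predecessor set.\<close>

lemma predecessors_subset:
  assumes "\<pi> \<in> permutations_of_set D" "z \<in> D"
  shows "predecessors \<pi> z \<subseteq> D - {z}"
proof -
  from assms obtain xs ys where "\<pi> = xs @ z # ys"
    by (metis permutations_of_setD(1) split_list)
  with assms show ?thesis
    by (auto simp: predecessors_append_Cons permutations_of_set_def)
qed

lemma bij_betw_permutations_with_predecessors:
  assumes "z \<in> D" "S \<subseteq> D - {z}"
  shows "bij_betw (\<lambda>(xs, ys). xs @ z # ys)
    (permutations_of_set S \<times> permutations_of_set (D - {z} - S))
    {\<pi> \<in> permutations_of_set D. predecessors \<pi> z = S}"
  unfolding bij_betw_def
proof (intro conjI subset_antisym subsetI)
  show "inj_on (\<lambda>(xs, ys). xs @ z # ys)
      (permutations_of_set S \<times> permutations_of_set (D - {z} - S))"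
    \<comment> \<open>All first components have length \<open>card S\<close>, so equal
      concatenations are cut at the same place.\<close>
    by (rule inj_onI)
      (auto simp: append_eq_append_conv length_finite_permutations_of_set)
next
  fix \<pi> assume "\<pi> \<in> (\<lambda>(xs, ys). xs @ z # ys) `
      (permutations_of_set S \<times> permutations_of_set (D - {z} - S))"
  then obtain xs ys where \<pi>: "\<pi> = xs @ z # ys"
    and "xs \<in> permutations_of_set S" "ys \<in> permutations_of_set (D - {z} - S)" by auto
  then have "set \<pi> = D" "distinct \<pi>" "set xs = S"
    using assms by (auto simp: permutations_of_set_def)
  then show "\<pi> \<in> {\<pi> \<in> permutations_of_set D. predecessors \<pi> z = S}"
    using \<pi> by (auto simp: predecessors_append_Cons intro: permutations_of_setI)
next
  fix \<pi> assume "\<pi> \<in> {\<pi> \<in> permutations_of_set D. predecessors \<pi> z = S}"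
  then have *: "set \<pi> = D" "distinct \<pi>" "predecessors \<pi> z = S"
    by (auto simp: permutations_of_set_def)
  \<comment> \<open>Surjectivity: the two pieces around \<open>z\<close> form the preimage.\<close>
  then obtain xs ys where \<pi>: "\<pi> = xs @ z # ys" using \<open>z \<in> D\<close> by (metis split_list)
  with * have "set xs = S" by (simp add: predecessors_append_Cons)
  with * \<pi> have "(xs, ys) \<in> permutations_of_set S \<times> permutations_of_set (D - {z} - S)"
    by (auto simp: permutations_of_set_def)
  with \<pi> show "\<pi> \<in> (\<lambda>(xs, ys). xs @ z # ys) `
      (permutations_of_set S \<times> permutations_of_set (D - {z} - S))"
    by (force intro: rev_image_eqI)
qed

lemma card_permutations_with_predecessors:
  assumes "finite D" "z \<in> D" "S \<subseteq> D - {z}"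
  shows "card {\<pi> \<in> permutations_of_set D. predecessors \<pi> z = S}
    = fact (card S) * fact (card D - 1 - card S)"
proof -
  have "finite S" using assms finite_subset by blast
  \<comment> \<open>Both natural-number subtractions are exact, since \<open>z\<close> lies in
    \<open>D\<close> and \<open>S\<close> is contained in \<open>D - {z}\<close>.\<close>
  then have "card (D - {z} - S) = card D - 1 - card S"
    using assms by (simp add: card_Diff_subset)
  with \<open>finite S\<close> show ?thesis
    using bij_betw_same_card[OF bij_betw_permutations_with_predecessors[OF assms(2,3)]] assms(1)
    by (simp add: card_cartesian_product)
qed

text \<open>The summand depends on an ordering only through the predecessors of \<open>z\<close>, so
  it is constant on each fibre and contributes its value times the fibre size.\<close>

lemma sum_permutations_eq_sum_predecessors:
  fixes g :: "'a set \<Rightarrow> 'b::semiring_char_0"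
  assumes "finite D" "z \<in> D"
  shows "(\<Sum>\<pi>\<in>permutations_of_set D. g (predecessors \<pi> z))
    = (\<Sum>S\<in>Pow (D - {z}). fact (card S) * fact (card D - 1 - card S) * g S)"
proof -
  have "(\<Sum>\<pi>\<in>permutations_of_set D. g (predecessors \<pi> z))
      = (\<Sum>S\<in>Pow (D - {z}). \<Sum>\<pi>\<in>{\<pi> \<in> permutations_of_set D. predecessors \<pi> z = S}.
           g (predecessors \<pi> z))"
    using assms predecessors_subset by (intro sum.group[symmetric]) fastforce+
  also have "\<dots> = (\<Sum>S\<in>Pow (D - {z}). fact (card S) * fact (card D - 1 - card S) * g S)"
    using assms by (intro sum.cong) (simp_all add: card_permutations_with_predecessors)
  finally show ?thesis .
qed

text \<open>Turns the share of orderings lying in one fibre into the Shapley weight, by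
  \<open>n! = n * (n - 1)!\<close> and the factorial formula for binomials; \<open>k < n\<close>
  gives both \<open>n > 0\<close> and \<open>k \<le> n - 1\<close>.\<close>

lemma fact_mult_fact_div_fact:
  assumes "k < n"
  shows "fact k * fact (n - 1 - k) / fact n
    = (1 / of_nat n * inverse (of_nat ((n - 1) choose k)) :: 'a::field_char_0)"
proof -
  have "fact n = (of_nat n * fact (n - 1) :: 'a)" using assms by (simp add: fact_reduce)
  moreover have "of_nat ((n - 1) choose k) = (fact (n - 1) / (fact k * fact (n - 1 - k)) :: 'a)"
    using assms by (intro binomial_fact) simp
  ultimately show ?thesis by simp
qed

text \<open>With one group there is no pair of indices \<open>s < t\<close>, so the order constraint
  is vacuous.\<close>

lemma grouped_permutations_single: "grouped_permutations [D] D = permutations_of_set D"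
  by (auto simp: grouped_permutations_def)

lemma permutation_weight_single:
  "\<pi> \<in> permutations_of_set D \<Longrightarrow> permutation_weight [D] D \<pi> = 1 / fact (card D)"
  by (simp add: permutation_weight_def grouped_permutations_single)

lemma asym_data_shapley_single:
  "asym_data_shapley [D] z v D = 1 / fact (card D) *
     (\<Sum>\<pi>\<in>permutations_of_set D. v (predecessors \<pi> z \<union> {z}) - v (predecessors \<pi> z))"
  unfolding asym_data_shapley_def sum_distrib_left
  by (intro sum.cong) (simp_all add: permutation_weight_single)

lemma shapley_permutation_form_eq_subset_form:
  fixes v :: "'a set \<Rightarrow> real"
  assumes "finite D" "z \<in> D"
  shows "1 / fact (card D) * (\<Sum>\<pi>\<in>permutations_of_set D.
      v (predecessors \<pi> z \<union> {z}) - v (predecessors \<pi> z))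
    = 1 / real (card D) * (\<Sum>S\<in>Pow (D - {z}).
      inverse (real ((card D - 1) choose card S)) * (v (S \<union> {z}) - v S))"
  unfolding sum_permutations_eq_sum_predecessors[OF assms, of "\<lambda>S. v (S \<union> {z}) - v S"]
    sum_distrib_left
proof (rule sum.cong[OF refl])
  fix S assume "S \<in> Pow (D - {z})"
  \<comment> \<open>\<open>S\<close> misses \<open>z\<close>, so it is a proper subset of
    \<open>D\<close>; this supplies the strict bound for the weight identity.\<close>
  then have "card S < card D" using assms by (intro psubset_card_mono) auto
  then show "1 / fact (card D) *
      (fact (card S) * fact (card D - 1 - card S) * (v (S \<union> {z}) - v S))
    = 1 / real (card D) *
      (inverse (real ((card D - 1) choose card S)) * (v (S \<union> {z}) - v S))"
    using fact_mult_fact_div_fact[of "card S" "card D", where ?'a = real]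
    by (simp add: mult.assoc[symmetric])
qed

theorem proposition4p3:
  fixes D :: "'a set" and v :: "'a set \<Rightarrow> real" and n :: nat and \<sigma> :: "'a set list"
  assumes "finite D" and "card D = n" and "n \<ge> 1" and "\<sigma> = [D]"
  shows "grouped_permutations \<sigma> D = permutations_of_set D
    \<and> (\<forall>\<pi>\<in>permutations_of_set D. permutation_weight \<sigma> D \<pi> = 1 / fact n)
    \<and> (\<forall>z\<in>D.
         asym_data_shapley \<sigma> z v D =
           1 / fact n * (\<Sum>\<pi>\<in>permutations_of_set D.
              v (predecessors \<pi> z \<union> {z}) - v (predecessors \<pi> z))
       \<and> 1 / fact n * (\<Sum>\<pi>\<in>permutations_of_set D.
              v (predecessors \<pi> z \<union> {z}) - v (predecessors \<pi> z)) =
           1 / real n * (\<Sum>S\<in>Pow (D - {z}).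
              inverse (real ((n - 1) choose card S)) * (v (S \<union> {z}) - v S)))"
proof -
  have D: "\<sigma> = [D]" "n = card D" using assms by simp_all
  show ?thesis
    \<comment> \<open>Once \<open>n\<close> is written as \<open>card D\<close>, each of the four
      conjuncts is an instance of a lemma above.\<close>
    unfolding D
    by (intro conjI ballI grouped_permutations_single permutation_weight_single
        asym_data_shapley_single shapley_permutation_form_eq_subset_form assms(1))
qed

end
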